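(* Let $\Omega\subset\mathbb{R}^d$, let $\mathcal{U},\mathcal{V}$ be Banach spaces with quadratic norms and covariance operators $\mathcal{K}_{\mathcal{U}}:\mathcal{U}^*\to\mathcal{U}$, $\mathcal{K}_{\mathcal{V}}:\mathcal{V}^*\to\mathcal{V}$, let $\beta>0$, and let $x_1,\dots,x_{M_\Omega}\in\operatorname{int}\Omega$, $x_{M_\Omega+1},\dots,x_M\in\partial\Omega$ with $1\le M_\Omega\le M$. Suppose that the structural Assumption 1 (see context) holds, and let $N_{\mathcal{U}},\boldsymbol{\phi},N_{\mathcal{V}},\boldsymbol{\psi},G$ be as defined in the context. Define matrices $\Theta\in\mathbb{R}^{N_{\mathcal{U}}\times N_{\mathcal{U}}}$ and $\Psi\in\mathbb{R}^{N_{\mathcal{V}}\times N_{\mathcal{V}}}$ by $$\Theta_{ij}=[\phi_i,\mathcal{K}_{\mathcal{U}}\phi_j],\ 1\le i,j\le N_{\mathcal{U}},\qquad \Psi_{ks}=[\psi_k,\mathcal{K}_{\mathcal{V}}\psi_s],\ 1\le k,s\le N_{\mathcal{V}},$$ and assume that $\Theta$ and $\Psi$ are invertible. Let $\boldsymbol{\chi}=(\chi_1,\dots,\chi_{N_{\mathcal{U}}})$ and $\boldsymbol{\eta}=(\eta_1,\dots,\eta_{N_{\mathcal{V}}})$ with $$\chi_i=\sum_{n=1}^{N_{\mathcal{U}}}\Theta^{-1}_{in}\mathcal{K}_{\mathcal{U}}\phi_n,\qquad \eta_i=\sum_{n=1}^{N_{\mathcal{V}}}\Psi^{-1}_{in}\mathcal{K}_{\mathcal{V}}\psi_n,$$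 where $\Theta^{-1}_{in},\Psi^{-1}_{in}$ are the $(i,n)$ entries of $\Theta^{-1},\Psi^{-1}$. Then $(u^\dagger,m^\dagger,\overline{H}^\dagger)$ is a solution of $$\min_{(u,m,\overline{H})\in\mathcal{U}\times\mathcal{V}\times\mathbb{R}}\|u\|_{\mathcal{U}}^2+\|m\|_{\mathcal{V}}^2+|\overline{H}|^2+\beta\Big|\frac{1}{M_\Omega}\sum_{i=1}^{M_\Omega}u(x_i)\Big|^2+\beta\Big|\frac{1}{M_\Omega}\sum_{i=1}^{M_\Omega}m(x_i)-1\Big|^2\quad\text{s.t. } G([\boldsymbol{\phi},u],[\boldsymbol{\psi},m],\overline{H})=0$$ if and only if $$u^\dagger=\boldsymbol{\chi}^T\boldsymbol{z}^\dagger,\qquad m^\dagger=\boldsymbol{\eta}^T\boldsymbol{\rho}^\dagger,\qquad \overline{H}^\dagger=\lambda^\dagger,$$ where $(\boldsymbol{z}^\dagger,\boldsymbol{\rho}^\dagger,\lambda^\dagger)$ is a minimizer of $$\min_{\boldsymbol{z}\in\mathbb{R}^{N_{\mathcal{U}}},\,\boldsymbol{\rho}\in\mathbb{R}^{N_{\mathcal{V}}},\,\lambda\in\mathbb{R}}\boldsymbol{z}^T\Theta^{-1}\boldsymbol{z}+\boldsymbol{\rho}^T\Psi^{-1}\boldsymbol{\rho}+|\lambda|^2+\beta\Big|\frac{1}{M_\Omega}\sum_{i=1}^{M_\Omega}z_i^{(1)}\Big|^2+\beta\Big|\frac{1}{M_\Omega}\sum_{i=1}^{M_\Omega}\rho_i^{(1)}-1\Big|^2\quad\text{s.t.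 } G(\boldsymbol{z},\boldsymbol{\rho},\lambda)=0 .$$
   Context: Spaces: $\mathcal{U}$ is a Banach space with dual $\mathcal{U}^*$ and duality pairing $[\cdot,\cdot]$; there is a covariance operator $\mathcal{K}_{\mathcal{U}}:\mathcal{U}^*\to\mathcal{U}$, linear, bijective, symmetric ($[\mathcal{K}_{\mathcal{U}}\phi,\psi]=[\mathcal{K}_{\mathcal{U}}\psi,\phi]$) and positive ($[\mathcal{K}_{\mathcal{U}}\phi,\phi]>0$ for $\phi\ne0$), with $\|u\|_{\mathcal{U}}^2=[\mathcal{K}_{\mathcal{U}}^{-1}u,u]$ for all $u\in\mathcal{U}$. The same holds for $\mathcal{V}$ with $\mathcal{K}_{\mathcal{V}}$. For a vector $\boldsymbol{\phi}=(\phi_1,\dots,\phi_P)$ of elements of $\mathcal{U}^*$, $[\boldsymbol{\phi},u]=([\phi_1,u],\dots,[\phi_P,u])$. Mean field game: one considers $\mathcal{P}(u^*,m^*,\overline{H}^* )(x)=0$ for $x\in\operatorname{int}\Omega$, $\mathcal{B}(u^*,m^* )(x)=0$ for $x\in\partial\Omega$, $\int_\Omega u^*dx=0$, $\int_\Omega m^*dx=1$, where $\mathcal{P}$ is a nonlinear (possibly vector-valued) differential operator and $\mathcal{B}$ a boundary operator; it is a standing assumption that this system has a unique classical solution $(u^*,m^*,\overline{H}^* )$. Assumption 1: for $1\le Q_b\le Q$, $1\le D_b\le D$ there exist bounded linear operators $L_1,\dots,L_{Q_b}\in\mathcal{L}(\mathcal{U};C(\partial\Omega))$, $L_{Q_b+1},\dots,L_Q\in\mathcal{L}(\mathcal{U};C(\operatorname{int}\Omega))$,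 $J_1,\dots,J_{D_b}\in\mathcal{L}(\mathcal{V};C(\partial\Omega))$, $J_{D_b+1},\dots,J_D\in\mathcal{L}(\mathcal{V};C(\operatorname{int}\Omega))$, and continuous nonlinear maps $P$, $B$ such that $\mathcal{P}(u,m,\overline{H})(x)=P(L_{Q_b+1}(u)(x),\dots,L_Q(u)(x),J_{D_b+1}(m)(x),\dots,J_D(m)(x),\overline{H})$ for $x\in\operatorname{int}\Omega$, and $\mathcal{B}(u,m)(x)=B(L_1(u)(x),\dots,L_{Q_b}(u)(x),J_1(m)(x),\dots,J_{D_b}(m)(x))$ for $x\in\partial\Omega$. Functionals: $\phi_i^{(q)}=\delta_{x_i}\circ L_q\in\mathcal{U}^*$ with $M_\Omega+1\le i\le M$ if $1\le q\le Q_b$ and $1\le i\le M_\Omega$ if $Q_b+1\le q\le Q$; $\psi_i^{(p)}=\delta_{x_i}\circ J_p\in\mathcal{V}^*$ with $M_\Omega+1\le i\le M$ if $1\le p\le D_b$ and $1\le i\le M_\Omega$ if $D_b+1\le p\le D$. $\boldsymbol{\phi}^{(q)}$ is the vector of the $\phi_i^{(q)}$ and $\boldsymbol{\phi}=(\boldsymbol{\phi}^{(1)},\dots,\boldsymbol{\phi}^{(Q)})$, of length $N_{\mathcal{U}}=(M-M_\Omega)Q_b+M_\Omega(Q-Q_b)$; similarly $\boldsymbol{\psi}=(\boldsymbol{\psi}^{(1)},\dots,\boldsymbol{\psi}^{(D)})$, of length $N_{\mathcal{V}}=(M-M_\Omega)D_b+M_\Omega(D-D_b)$. The components of $\boldsymbol{\phi},\boldsymbol{\psi}$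 are also written $\phi_i,\psi_i$. The map $G$ is defined by: $(G([\boldsymbol{\phi},u],[\boldsymbol{\psi},m],\overline{H}))_i=P([\phi_i^{(Q_b+1)},u],\dots,[\phi_i^{(Q)},u],[\psi_i^{(D_b+1)},m],\dots,[\psi_i^{(D)},m],\overline{H})$ for $1\le i\le M_\Omega$, and $=B([\phi_i^{(1)},u],\dots,[\phi_i^{(Q_b)},u],[\psi_i^{(1)},m],\dots,[\psi_i^{(D_b)},m])$ for $M_\Omega+1\le i\le M$; $G(\boldsymbol{z},\boldsymbol{\rho},\lambda)$ is obtained by replacing $[\boldsymbol{\phi},u],[\boldsymbol{\psi},m],\overline{H}$ by $\boldsymbol{z},\boldsymbol{\rho},\lambda$. Convention: the point evaluations $u\mapsto u(x_i)$ and $m\mapsto m(x_i)$, $1\le i\le M_\Omega$, are among the functionals in $\boldsymbol{\phi}$ and $\boldsymbol{\psi}$ respectively, and $z_i^{(1)}$, $\rho_i^{(1)}$ ($1\le i\le M_\Omega$) denote the corresponding components of $\boldsymbol{z}$ and $\boldsymbol{\rho}$. *)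

theory Defs
  imports "HOL-Analysis.Analysis" "Jordan_Normal_Form.Gauss_Jordan_Elimination"
begin

section \<open>Banach spaces with quadratic norm\<close>

text \<open>The dual of a Banach space \<open>'u\<close> is the type of bounded linear functionals on \<open>'u\<close> with
  values in the reals; the duality pairing of \<open>f\<close> and \<open>u\<close> is \<open>blinfun_apply f u\<close>.\<close>

definition covariance_operator :: "(('u::banach \<Rightarrow>\<^sub>L real) \<Rightarrow> 'u) \<Rightarrow> bool" where
  "covariance_operator K \<longleftrightarrow>
     linear K \<and> bij K \<and>
     (\<forall>f g. blinfun_apply g (K f) = blinfun_apply f (K g)) \<and>
     (\<forall>f. f \<noteq> 0 \<longrightarrow> blinfun_apply f (K f) > 0) \<and>
     (\<forall>u. (norm u)\<^sup>2 = blinfun_apply (inv_into UNIV K u) u)"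

text \<open>The elements of the Banach spaces are real-valued functions on the closure of the domain:
  \<open>ev u x\<close> is the value \<open>u(x)\<close>. Values of \<open>ev u\<close> off \<open>A\<close> carry no information.\<close>

definition realizes_functions_on :: "'a set \<Rightarrow> ('u::real_vector \<Rightarrow> 'a \<Rightarrow> real) \<Rightarrow> bool" where
  "realizes_functions_on A ev \<longleftrightarrow>
     (\<forall>u v. \<forall>x\<in>A. ev (u + v) x = ev u x + ev v x) \<and>
     (\<forall>c u. \<forall>x\<in>A. ev (c *\<^sub>R u) x = c * ev u x) \<and>
     (\<forall>u v. (\<forall>x\<in>A. ev u x = ev v x) \<longrightarrow> u = v)"

text \<open>Bounded linear operators from a Banach space into \<open>C(A)\<close>, which carries the topology of
  uniform convergence on compact subsets. If \<open>A\<close> is compact this is the sup-norm topology. For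
  non-compact \<open>A\<close> (such as the interior of a domain) every operator that is bounded with respect to
  the supremum over all of \<open>A\<close> is covered as well.\<close>

definition bounded_linear_into_C ::
    "'a::topological_space set \<Rightarrow> ('u::real_normed_vector \<Rightarrow> 'a \<Rightarrow> real) \<Rightarrow> bool" where
  "bounded_linear_into_C A L \<longleftrightarrow>
     (\<forall>u. continuous_on A (L u)) \<and>
     (\<forall>u v. \<forall>x\<in>A. L (u + v) x = L u x + L v x) \<and>
     (\<forall>c u. \<forall>x\<in>A. L (c *\<^sub>R u) x = c * L u x) \<and>
     (\<forall>S. compact S \<and> S \<subseteq> A \<longrightarrow> (\<exists>b. \<forall>u. \<forall>x\<in>S. \<bar>L u x\<bar> \<le> b * norm u))"


section \<open>The mean field game\<close>

text \<open>\<open>iter_pderiv [e1, \<dots>, ek] f\<close> is the iterated partial derivative of \<open>f\<close> in the coordinate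
  directions \<open>e1, \<dots>, ek\<close>.\<close>

primrec iter_pderiv :: "'a list \<Rightarrow> ('a::euclidean_space \<Rightarrow> real) \<Rightarrow> 'a \<Rightarrow> real" where
  "iter_pderiv [] f = f"
| "iter_pderiv (e # es) f = (\<lambda>x. frechet_derivative (iter_pderiv es f) (at x) e)"

definition coord_dirs :: "nat \<Rightarrow> 'a::euclidean_space list set" where
  "coord_dirs k = {es. set es \<subseteq> Basis \<and> length es \<le> k}"

definition C_k_on :: "nat \<Rightarrow> 'a::euclidean_space set \<Rightarrow> ('a \<Rightarrow> real) \<Rightarrow> bool" where
  "C_k_on k S f \<longleftrightarrow>
     (\<forall>es \<in> coord_dirs k. continuous_on S (iter_pderiv es f)) \<and>
     (\<forall>es \<in> coord_dirs k. length es < k \<longrightarrow> (\<forall>x\<in>S. iter_pderiv es f differentiable (at x)))"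

definition jet :: "nat \<Rightarrow> ('a::euclidean_space \<Rightarrow> real) \<Rightarrow> 'a \<Rightarrow> 'a list \<Rightarrow> real" where
  "jet k f x = (\<lambda>es. if es \<in> coord_dirs k then iter_pderiv es f x else 0)"

text \<open>At a boundary point, derivatives of positive order are limits of the derivatives in the
  interior.\<close>

definition boundary_jet ::
    "'a::euclidean_space set \<Rightarrow> nat \<Rightarrow> ('a \<Rightarrow> real) \<Rightarrow> 'a \<Rightarrow> 'a list \<Rightarrow> real" where
  "boundary_jet \<Omega> l f x =
     (\<lambda>es. if es \<in> coord_dirs l
           then if es = [] then f x else Lim (at x within interior \<Omega>) (iter_pderiv es f)
           else 0)"

text \<open>Classical regularity for an interior operator of order at most \<open>k\<close> and a boundary operator
  of order at most \<open>l\<close>: all derivatives that can occur exist and are continuous in the interior, and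
  those up to order \<open>l\<close> extend continuously to the boundary.\<close>

definition classical :: "'a::euclidean_space set \<Rightarrow> nat \<Rightarrow> nat \<Rightarrow> ('a \<Rightarrow> real) \<Rightarrow> bool" where
  "classical \<Omega> k l f \<longleftrightarrow>
     C_k_on (max k l) (interior \<Omega>) f \<and>
     continuous_on (closure \<Omega>) f \<and>
     (\<forall>es \<in> coord_dirs l. \<forall>x \<in> frontier \<Omega>.
        \<exists>c. (iter_pderiv es f \<longlongrightarrow> c) (at x within interior \<Omega>))"

definition differential_operator ::
    "'a::euclidean_space set \<Rightarrow> nat \<Rightarrow> (('a \<Rightarrow> real) \<Rightarrow> ('a \<Rightarrow> real) \<Rightarrow> real \<Rightarrow> 'a \<Rightarrow> 'p) \<Rightarrow> bool" where
  "differential_operator \<Omega> k \<P> \<longleftrightarrow>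
     (\<exists>F. \<forall>u m H. C_k_on k (interior \<Omega>) u \<and> C_k_on k (interior \<Omega>) m \<longrightarrow>
        (\<forall>x \<in> interior \<Omega>. \<P> u m H x = F x (jet k u x) (jet k m x) H))"

definition boundary_operator ::
    "'a::euclidean_space set \<Rightarrow> nat \<Rightarrow> nat \<Rightarrow> (('a \<Rightarrow> real) \<Rightarrow> ('a \<Rightarrow> real) \<Rightarrow> 'a \<Rightarrow> 'b) \<Rightarrow> bool" where
  "boundary_operator \<Omega> k l \<B> \<longleftrightarrow>
     (\<exists>F. \<forall>u m. classical \<Omega> k l u \<and> classical \<Omega> k l m \<longrightarrow>
        (\<forall>x \<in> frontier \<Omega>. \<B> u m x = F x (boundary_jet \<Omega> l u x) (boundary_jet \<Omega> l m x)))"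

definition mfg_classical_solution ::
    "'a::euclidean_space set \<Rightarrow> nat \<Rightarrow> nat \<Rightarrow>
     (('a \<Rightarrow> real) \<Rightarrow> ('a \<Rightarrow> real) \<Rightarrow> real \<Rightarrow> 'a \<Rightarrow> 'p::zero) \<Rightarrow>
     (('a \<Rightarrow> real) \<Rightarrow> ('a \<Rightarrow> real) \<Rightarrow> 'a \<Rightarrow> 'b::zero) \<Rightarrow>
     ('a \<Rightarrow> real) \<Rightarrow> ('a \<Rightarrow> real) \<Rightarrow> real \<Rightarrow> bool" where
  "mfg_classical_solution \<Omega> k l \<P> \<B> u m H \<longleftrightarrow>
     classical \<Omega> k l u \<and> classical \<Omega> k l m \<and>
     (\<forall>x \<in> interior \<Omega>. \<P> u m H x = 0) \<and>
     (\<forall>x \<in> frontier \<Omega>. \<B> u m x = 0) \<and>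
     set_integrable lebesgue \<Omega> u \<and> set_lebesgue_integral lebesgue \<Omega> u = 0 \<and>
     set_integrable lebesgue \<Omega> m \<and> set_lebesgue_integral lebesgue \<Omega> m = 1"

text \<open>Existence and uniqueness; functions are identified when they agree on the closure of the
  domain.\<close>

definition mfg_uniquely_solvable ::
    "'a::euclidean_space set \<Rightarrow> nat \<Rightarrow> nat \<Rightarrow>
     (('a \<Rightarrow> real) \<Rightarrow> ('a \<Rightarrow> real) \<Rightarrow> real \<Rightarrow> 'a \<Rightarrow> 'p::zero) \<Rightarrow>
     (('a \<Rightarrow> real) \<Rightarrow> ('a \<Rightarrow> real) \<Rightarrow> 'a \<Rightarrow> 'b::zero) \<Rightarrow> bool" where
  "mfg_uniquely_solvable \<Omega> k l \<P> \<B> \<longleftrightarrow>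
     (\<exists>u m H. mfg_classical_solution \<Omega> k l \<P> \<B> u m H \<and>
        (\<forall>u' m' H'. mfg_classical_solution \<Omega> k l \<P> \<B> u' m' H' \<longrightarrow>
           (\<forall>x \<in> closure \<Omega>. u' x = u x \<and> m' x = m x) \<and> H' = H))"


section \<open>The structural assumption\<close>

text \<open>\<open>tuple n f\<close> is the vector \<open>(f 1, \<dots>, f n)\<close>, a point of \<open>Euclidean_space n\<close>; its coordinates
  are indexed from 0.\<close>

definition tuple :: "nat \<Rightarrow> (nat \<Rightarrow> real) \<Rightarrow> nat \<Rightarrow> real" where
  "tuple n f = (\<lambda>k. if k < n then f (Suc k) else 0)"

lemma tuple_in_Euclidean_space: "tuple n f \<in> topspace (Euclidean_space n)"
  by (simp add: tuple_def topspace_Euclidean_space)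

text \<open>The operators \<open>L 1, \<dots>, L Q\<close> and \<open>J 1, \<dots>, J D\<close>, of which the first \<open>Qb\<close> respectively \<open>Db\<close> are
  boundary operators.\<close>

definition structural_assumption ::
    "'a::euclidean_space set \<Rightarrow>
     ('u::banach \<Rightarrow> 'a \<Rightarrow> real) \<Rightarrow> ('v::banach \<Rightarrow> 'a \<Rightarrow> real) \<Rightarrow>
     (('a \<Rightarrow> real) \<Rightarrow> ('a \<Rightarrow> real) \<Rightarrow> real \<Rightarrow> 'a \<Rightarrow> 'p::euclidean_space) \<Rightarrow>
     (('a \<Rightarrow> real) \<Rightarrow> ('a \<Rightarrow> real) \<Rightarrow> 'a \<Rightarrow> 'b::euclidean_space) \<Rightarrow>
     nat \<Rightarrow> nat \<Rightarrow> (nat \<Rightarrow> 'u \<Rightarrow> 'a \<Rightarrow> real) \<Rightarrow>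
     nat \<Rightarrow> nat \<Rightarrow> (nat \<Rightarrow> 'v \<Rightarrow> 'a \<Rightarrow> real) \<Rightarrow>
     ((nat \<Rightarrow> real) \<Rightarrow> (nat \<Rightarrow> real) \<Rightarrow> real \<Rightarrow> 'p) \<Rightarrow>
     ((nat \<Rightarrow> real) \<Rightarrow> (nat \<Rightarrow> real) \<Rightarrow> 'b) \<Rightarrow> bool" where
  "structural_assumption \<Omega> evU evV \<P> \<B> Qb Q L Db D J P B \<longleftrightarrow>
     1 \<le> Qb \<and> Qb \<le> Q \<and> 1 \<le> Db \<and> Db \<le> D \<and>
     (\<forall>q. 1 \<le> q \<and> q \<le> Qb \<longrightarrow> bounded_linear_into_C (frontier \<Omega>) (L q)) \<and>
     (\<forall>q. Qb + 1 \<le> q \<and> q \<le> Q \<longrightarrow> bounded_linear_into_C (interior \<Omega>) (L q)) \<and>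
     (\<forall>p. 1 \<le> p \<and> p \<le> Db \<longrightarrow> bounded_linear_into_C (frontier \<Omega>) (J p)) \<and>
     (\<forall>p. Db + 1 \<le> p \<and> p \<le> D \<longrightarrow> bounded_linear_into_C (interior \<Omega>) (J p)) \<and>
     continuous_map
       (prod_topology (Euclidean_space (Q - Qb))
          (prod_topology (Euclidean_space (D - Db)) euclideanreal))
       euclidean (\<lambda>(a, b, h). P a b h) \<and>
     continuous_map
       (prod_topology (Euclidean_space Qb) (Euclidean_space Db)) euclidean (\<lambda>(a, b). B a b) \<and>
     (\<forall>u m H. \<forall>x \<in> interior \<Omega>.
        \<P> (evU u) (evV m) H x =
        P (tuple (Q - Qb) (\<lambda>q. L (Qb + q) u x)) (tuple (D - Db) (\<lambda>p. J (Db + p) m x)) H) \<and>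
     (\<forall>u m. \<forall>x \<in> frontier \<Omega>.
        \<B> (evU u) (evV m) x =
        B (tuple Qb (\<lambda>q. L q u x)) (tuple Db (\<lambda>p. J p m x)))"


section \<open>Measurement functionals and the constraint map\<close>

text \<open>Sample points \<open>x 1, \<dots>, x M\<close> are numbered from 1, the first \<open>M\<Omega>\<close> of them being interior. A list
  of \<open>n\<close> operators whose first \<open>b\<close> ones are boundary operators gives rise to measurements labelled by
  pairs \<open>(q, i)\<close> (operator, sample point), which \<open>labels\<close> lists block by block. Vectors and matrices
  are those of \<open>Jordan_Normal_Form\<close>, hence indexed from 0.\<close>

definition labels :: "nat \<Rightarrow> nat \<Rightarrow> nat \<Rightarrow> nat \<Rightarrow> (nat \<times> nat) list" where
  "labels M\<Omega> M b n =
     concat (map (\<lambda>q. map (\<lambda>i. (q, i)) (if q \<le> b then [Suc M\<Omega>..<Suc M] else [1..<Suc M\<Omega>]))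
       [1..<Suc n])"

definition num_labels :: "nat \<Rightarrow> nat \<Rightarrow> nat \<Rightarrow> nat \<Rightarrow> nat" where
  "num_labels M\<Omega> M b n = (M - M\<Omega>) * b + M\<Omega> * (n - b)"

definition label_pos :: "nat \<Rightarrow> nat \<Rightarrow> nat \<Rightarrow> nat \<Rightarrow> nat \<Rightarrow> nat" where
  "label_pos M\<Omega> M b q i =
     (if q \<le> b then (M - M\<Omega>) * (q - 1) + (i - M\<Omega> - 1)
      else (M - M\<Omega>) * b + M\<Omega> * (q - b - 1) + (i - 1))"

lemma labels_Suc:
  "labels M\<Omega> M b (Suc n) =
     labels M\<Omega> M b n @ map (\<lambda>i. (Suc n, i)) (if Suc n \<le> b then [Suc M\<Omega>..<Suc M] else [1..<Suc M\<Omega>])"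
  by (simp add: labels_def)

lemma length_labels_le: "n \<le> b \<Longrightarrow> length (labels M\<Omega> M b n) = (M - M\<Omega>) * n"
  by (induction n) (simp add: labels_def, simp add: labels_Suc del: upt_Suc)

lemma length_labels:
  assumes "b \<le> n" shows "length (labels M\<Omega> M b n) = num_labels M\<Omega> M b n"
  using assms
proof (induction n rule: dec_induct)
  case base
  show ?case by (simp add: length_labels_le num_labels_def)
next
  case (step n)
  then show ?case by (simp add: labels_Suc num_labels_def Suc_diff_le del: upt_Suc)
qed

lemma labels_nth_label_pos:
  assumes "1 \<le> q" "q \<le> n"
    and "if q \<le> b then Suc M\<Omega> \<le> i \<and> i \<le> M else 1 \<le> i \<and> i \<le> M\<Omega>"
  shows "label_pos M\<Omega> M b q i < length (labels M\<Omega> M b n) \<and>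
         labels M\<Omega> M b n ! label_pos M\<Omega> M b q i = (q, i)"
  using assms(2)
proof (induction n rule: dec_induct)
  case base
  from assms(1) obtain r where r: "q = Suc r" by (cases q) auto
  have len: "length (labels M\<Omega> M b r) =
      (if q \<le> b then (M - M\<Omega>) * r else (M - M\<Omega>) * b + M\<Omega> * (r - b))"
    using r by (simp add: length_labels_le length_labels num_labels_def)
  define ps where "ps = (if q \<le> b then [Suc M\<Omega>..<Suc M] else [1..<Suc M\<Omega>])"
  define j where "j = (if q \<le> b then i - M\<Omega> - 1 else i - 1)"
  have lab: "labels M\<Omega> M b q = labels M\<Omega> M b r @ map (\<lambda>i. (q, i)) ps"
    using r by (simp only: labels_Suc ps_def)
  have j: "j < length ps" "ps ! j = i"
    using assms(3) by (auto simp: ps_def j_def simp del: upt_Suc split: if_splits)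
  have pos: "label_pos M\<Omega> M b q i = length (labels M\<Omega> M b r) + j"
    using r len by (simp add: label_pos_def j_def)
  show ?case
    unfolding lab pos using j by (simp add: nth_append_length_plus)
next
  case (step n)
  then show ?case by (simp add: labels_Suc nth_append)
qed

text \<open>The functional \<open>\<delta>\<^sub>x \<circ> L\<close>.\<close>

definition point_functional :: "('u::banach \<Rightarrow> 'a \<Rightarrow> real) \<Rightarrow> 'a \<Rightarrow> ('u \<Rightarrow>\<^sub>L real)" where
  "point_functional L x = Blinfun (\<lambda>u. L u x)"

lemma point_functional_apply:
  fixes L :: "'u::banach \<Rightarrow> 'a::t1_space \<Rightarrow> real"
  assumes "bounded_linear_into_C A L" "x \<in> A"
  shows "blinfun_apply (point_functional L x) u = L u x"
proof -
  from assms have add: "L (v + w) x = L v x + L w x" and scale: "L (c *\<^sub>R v) x = c * L v x" for v w c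
    by (auto simp: bounded_linear_into_C_def)
  have "compact {x} \<and> {x} \<subseteq> A" using assms(2) by simp
  with assms(1) obtain b where "\<And>v. \<bar>L v x\<bar> \<le> b * norm v"
    unfolding bounded_linear_into_C_def by (metis singletonI)
  then have "bounded_linear (\<lambda>v. L v x)"
    by (intro bounded_linear_intro[where K = b]) (auto simp: add scale mult.commute)
  then show ?thesis by (simp add: point_functional_def bounded_linear_Blinfun_apply)
qed

definition measurements ::
    "nat \<Rightarrow> nat \<Rightarrow> nat \<Rightarrow> nat \<Rightarrow> (nat \<Rightarrow> 'a) \<Rightarrow> (nat \<Rightarrow> 'u::banach \<Rightarrow> 'a \<Rightarrow> real) \<Rightarrow> ('u \<Rightarrow>\<^sub>L real) list"
  where
  "measurements M\<Omega> M b n x L = map (\<lambda>(q, i). point_functional (L q) (x i)) (labels M\<Omega> M b n)"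

definition pairing_vec :: "('u::banach \<Rightarrow>\<^sub>L real) list \<Rightarrow> 'u \<Rightarrow> real Matrix.vec" where
  "pairing_vec \<phi> u = Matrix.vec (length \<phi>) (\<lambda>n. blinfun_apply (\<phi> ! n) u)"

text \<open>Interior and boundary components of \<open>G\<close> live in different spaces, the codomains of \<open>P\<close> and
  \<open>B\<close>; they are placed in the first respectively second factor of a product whose other factor is
  \<open>0\<close>. Hence \<open>G\<close> vanishes iff each of its \<open>M\<close> components does.\<close>

definition constraint_map ::
    "nat \<Rightarrow> nat \<Rightarrow> nat \<Rightarrow> nat \<Rightarrow> nat \<Rightarrow> nat \<Rightarrow>
     ((nat \<Rightarrow> real) \<Rightarrow> (nat \<Rightarrow> real) \<Rightarrow> real \<Rightarrow> 'p::zero) \<Rightarrow>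
     ((nat \<Rightarrow> real) \<Rightarrow> (nat \<Rightarrow> real) \<Rightarrow> 'b::zero) \<Rightarrow>
     real Matrix.vec \<Rightarrow> real Matrix.vec \<Rightarrow> real \<Rightarrow> nat \<Rightarrow> 'p \<times> 'b" where
  "constraint_map M\<Omega> M Qb Q Db D P B z \<rho> \<mu> =
     (\<lambda>i. if 1 \<le> i \<and> i \<le> M\<Omega> then
            (P (tuple (Q - Qb) (\<lambda>q. vec_index z (label_pos M\<Omega> M Qb (Qb + q) i)))
               (tuple (D - Db) (\<lambda>p. vec_index \<rho> (label_pos M\<Omega> M Db (Db + p) i))) \<mu>, 0)
          else if M\<Omega> + 1 \<le> i \<and> i \<le> M then
            (0, B (tuple Qb (\<lambda>q. vec_index z (label_pos M\<Omega> M Qb q i)))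
                  (tuple Db (\<lambda>p. vec_index \<rho> (label_pos M\<Omega> M Db p i))))
          else (0, 0))"


section \<open>Gram matrices and representers\<close>

definition gram_mat :: "(('u::banach \<Rightarrow>\<^sub>L real) \<Rightarrow> 'u) \<Rightarrow> ('u \<Rightarrow>\<^sub>L real) list \<Rightarrow> real Matrix.mat" where
  "gram_mat K \<phi> =
     Matrix.mat (length \<phi>) (length \<phi>) (\<lambda>(i, j). blinfun_apply (\<phi> ! i) (K (\<phi> ! j)))"

text \<open>The inverse of an invertible matrix (unspecified otherwise).\<close>

definition inverse_mat :: "real Matrix.mat \<Rightarrow> real Matrix.mat" where
  "inverse_mat A = the (mat_inverse A)"

definition representer :: "(('u::banach \<Rightarrow>\<^sub>L real) \<Rightarrow> 'u) \<Rightarrow> ('u \<Rightarrow>\<^sub>L real) list \<Rightarrow> nat \<Rightarrow> 'u" where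
  "representer K \<phi> i =
     (\<Sum>n < length \<phi>. (inverse_mat (gram_mat K \<phi>) $$ (i, n)) *\<^sub>R K (\<phi> ! n))"

definition quad_form :: "real Matrix.mat \<Rightarrow> real Matrix.vec \<Rightarrow> real" where
  "quad_form A z = scalar_prod z (A *\<^sub>v z)"

end

theory Submission
  imports Defs
begin

text \<open>A covariance operator \<open>K\<close> turns the Banach space into a Hilbert space, with the inner product
  \<open>[K\<^sup>-\<^sup>1 u, v]\<close>, and \<open>K f\<close> is the Riesz representer of the functional \<open>f\<close>. Taking measurements
  \<open>u \<mapsto> [\<phi>, u]\<close> therefore loses exactly the component of \<open>u\<close> orthogonal to the span of the
  \<open>K \<phi>\<^sub>n\<close>, and \<open>z \<mapsto> \<chi>\<^sup>T z\<close> is a right inverse of this map with values in that span. By Pythagoras,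
  \<open>\<chi>\<^sup>T [\<phi>, u]\<close> is the unique element of least norm among those with the same measurements as \<open>u\<close>
  (\<open>norm_interpolant_pairing_vec_le\<close>, \<open>interpolant_eq_if_norm_eq\<close>), and the square of the norm of
  \<open>\<chi>\<^sup>T z\<close> is \<open>z\<^sup>T \<Theta>\<^sup>-\<^sup>1 z\<close> (\<open>norm_interpolant\<close>).

  Constraint and penalty terms see \<open>u\<close> and \<open>m\<close> through their measurements alone. Replacing a
  feasible \<open>(u, m, H)\<close> by the interpolants of its measurements thus preserves feasibility, never
  increases the objective, and strictly decreases it unless nothing changed. The finite-dimensional
  problem is the restriction of the original one to interpolants, so the two have the same
  minimizers; \<open>is_arg_min_retract\<close> isolates this last argument.\<close>

section \<open>Minimization over a section\<close>

text \<open>Here \<open>p\<close> forgets all but the data on which the constraint depends and \<open>r\<close> reconstructs a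
  canonical candidate. Every minimizer is a fixed point of \<open>r \<circ> p\<close>, for otherwise \<open>r (p a)\<close> would be a
  strictly better candidate, and on the range of \<open>r\<close> the two objectives coincide.\<close>

lemma is_arg_min_retract:
  fixes F :: "'x \<Rightarrow> 'o::linorder" and F' :: "'y \<Rightarrow> 'o"
  assumes p: "\<And>a. C a \<Longrightarrow> C' (p a)"
    and r: "\<And>b. C' b \<Longrightarrow> C (r b)"
    and section_p: "\<And>b. C' b \<Longrightarrow> p (r b) = b"
    and F': "\<And>b. C' b \<Longrightarrow> F' b = F (r b)"
    and le: "\<And>a. C a \<Longrightarrow> F (r (p a)) \<le> F a"
    and eq: "\<And>a. C a \<Longrightarrow> F (r (p a)) = F a \<Longrightarrow> r (p a) = a"
  shows "is_arg_min F C a \<longleftrightarrow> (\<exists>b. is_arg_min F' C' b \<and> a = r b)"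
proof
  assume a: "is_arg_min F C a"
  then have C: "C a" and min: "\<And>y. C y \<Longrightarrow> F a \<le> F y"
    by (auto simp: is_arg_min_linorder)
  have fixed: "r (p a) = a"
    using C by (intro eq antisym le min r p)
  have "is_arg_min F' C' (p a)"
    unfolding is_arg_min_linorder using C min p r F' fixed by simp
  with fixed show "\<exists>b. is_arg_min F' C' b \<and> a = r b"
    by metis
next
  assume "\<exists>b. is_arg_min F' C' b \<and> a = r b"
  then obtain b where C': "C' b" and min: "\<And>y. C' y \<Longrightarrow> F' b \<le> F' y" and a: "a = r b"
    by (auto simp: is_arg_min_linorder)
  have "F a \<le> F y" if "C y" for y
  proof -
    have "F a = F' b" using a C' F' by simp
    also have "\<dots> \<le> F' (p y)" using that by (intro min p)
    also have "\<dots> = F (r (p y))" using that by (intro F' p)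
    also have "\<dots> \<le> F y" using that by (rule le)
    finally show ?thesis .
  qed
  with a C' r show "is_arg_min F C a"
    by (simp add: is_arg_min_linorder)
qed

section \<open>Optimal interpolation in a space with quadratic norm\<close>

text \<open>For an invertible Gram matrix, the element of least norm with measurements \<open>z\<close>.\<close>

definition interpolant :: "(('u::banach \<Rightarrow>\<^sub>L real) \<Rightarrow> 'u) \<Rightarrow> ('u \<Rightarrow>\<^sub>L real) list \<Rightarrow> real Matrix.vec \<Rightarrow> 'u"
  where "interpolant K \<phi> z = (\<Sum>i < length \<phi>. vec_index z i *\<^sub>R representer K \<phi> i)"

lemma pairing_vec_carrier: "pairing_vec \<phi> u \<in> carrier_vec (length \<phi>)"
  by (simp add: pairing_vec_def)

lemma norm_sq_covariance:
  assumes "covariance_operator K"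
  shows "(norm (K f))\<^sup>2 = blinfun_apply f (K f)"
  using assms by (simp add: covariance_operator_def bij_is_inj)

lemma inverse_mat_left:
  assumes "invertible_mat A" and A: "A \<in> carrier_mat n n"
  shows "inverse_mat A \<in> carrier_mat n n" and "inverse_mat A * A = 1\<^sub>m n"
proof -
  obtain B where "inverts_mat A B" "inverts_mat B A"
    using assms by (auto simp: invertible_mat_def)
  then have AB: "A * B = 1\<^sub>m n" and BA: "B * A = 1\<^sub>m (dim_row B)"
    using A by (auto simp: inverts_mat_def)
  have "B \<in> carrier_mat n n"
  proof
    show "dim_col B = n"
      using arg_cong[OF AB, of dim_col] by simp
    show "dim_row B = n"
      using arg_cong[OF BA, of dim_col] A by simp
  qed
  with AB BA A have "A \<in> Units (ring_mat TYPE(real) n undefined)"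
    by (auto simp: Units_def ring_mat_def)
  with mat_inverse(1)[OF A, of undefined] obtain C where C: "mat_inverse A = Some C"
    by (cases "mat_inverse A") auto
  from mat_inverse(2)[OF A C] C
  show "inverse_mat A \<in> carrier_mat n n" and "inverse_mat A * A = 1\<^sub>m n"
    by (auto simp: inverse_mat_def)
qed

text \<open>Exchanging the two summations exhibits the interpolant as the Riesz representer of a functional
  in the span of the measurements.\<close>

lemma interpolant_eq_covariance:
  assumes "covariance_operator K"
  shows "interpolant K \<phi> z =
    K (\<Sum>n < length \<phi>.
         (\<Sum>i < length \<phi>. vec_index z i * inverse_mat (gram_mat K \<phi>) $$ (i, n)) *\<^sub>R \<phi> ! n)"
proof -
  have lin: "linear K" using assms by (simp add: covariance_operator_def)
  have "interpolant K \<phi> z =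
    (\<Sum>n < length \<phi>. \<Sum>i < length \<phi>.
       (vec_index z i * inverse_mat (gram_mat K \<phi>) $$ (i, n)) *\<^sub>R K (\<phi> ! n))"
    unfolding interpolant_def representer_def scaleR_sum_right scaleR_scaleR by (rule sum.swap)
  then show ?thesis
    by (simp add: linear_sum[OF lin] linear_scale[OF lin] scaleR_sum_left)
qed

text \<open>Symmetry of \<open>K\<close> makes the Gram matrix symmetric, so that \<open>\<phi>\<^sub>k\<close> applied to \<open>\<chi>\<^sub>i\<close> is the entry
  \<open>(i, k)\<close> of \<open>\<Theta>\<^sup>-\<^sup>1 \<Theta>\<close>: the representers are dual to the measurements.\<close>

lemma blinfun_apply_representer:
  assumes K: "covariance_operator K" and inv: "invertible_mat (gram_mat K \<phi>)"
    and i: "i < length \<phi>" and k: "k < length \<phi>"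
  shows "blinfun_apply (\<phi> ! k) (representer K \<phi> i) = (if i = k then 1 else 0)"
proof -
  let ?N = "length \<phi>" and ?T = "gram_mat K \<phi>"
  have T: "?T \<in> carrier_mat ?N ?N" by (simp add: gram_mat_def)
  note I = inverse_mat_left[OF inv T]
  have sym: "blinfun_apply (\<phi> ! k) (K (\<phi> ! n)) = ?T $$ (n, k)" if "n < ?N" for n
    using K k that by (simp add: gram_mat_def covariance_operator_def)
  have "blinfun_apply (\<phi> ! k) (representer K \<phi> i) =
      (\<Sum>n < ?N. inverse_mat ?T $$ (i, n) * ?T $$ (n, k))"
    by (simp add: representer_def blinfun.sum_right blinfun.scaleR_right sym)
  also have "\<dots> = (inverse_mat ?T * ?T) $$ (i, k)"
    using I(1) T i k by (simp add: scalar_prod_def atLeast0LessThan)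
  finally show ?thesis using I(2) i k by simp
qed

lemma pairing_vec_interpolant:
  assumes "covariance_operator K" and "invertible_mat (gram_mat K \<phi>)"
    and "z \<in> carrier_vec (length \<phi>)"
  shows "pairing_vec \<phi> (interpolant K \<phi> z) = z"
proof (rule eq_vecI)
  fix k assume "k < dim_vec z"
  then show "vec_index (pairing_vec \<phi> (interpolant K \<phi> z)) k = vec_index z k"
    using assms
    by (simp add: pairing_vec_def interpolant_def blinfun.sum_right blinfun.scaleR_right
        blinfun_apply_representer if_distrib cong: if_cong)
qed (use assms in \<open>simp add: pairing_vec_def\<close>)

lemma norm_interpolant:
  assumes K: "covariance_operator K" and inv: "invertible_mat (gram_mat K \<phi>)"
    and z: "z \<in> carrier_vec (length \<phi>)"
  shows "(norm (interpolant K \<phi> z))\<^sup>2 = quad_form (inverse_mat (gram_mat K \<phi>)) z"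
proof -
  let ?N = "length \<phi>" and ?I = "inverse_mat (gram_mat K \<phi>)"
  have "gram_mat K \<phi> \<in> carrier_mat ?N ?N" by (simp add: gram_mat_def)
  note I = inverse_mat_left(1)[OF inv this]
  have meas: "blinfun_apply (\<phi> ! n) (interpolant K \<phi> z) = vec_index z n" if "n < ?N" for n
    using arg_cong[OF pairing_vec_interpolant[OF assms], of "\<lambda>v. vec_index v n"] that
    by (simp add: pairing_vec_def)
  define f where "f = (\<Sum>n < ?N. (\<Sum>i < ?N. vec_index z i * ?I $$ (i, n)) *\<^sub>R \<phi> ! n)"
  have Kf: "interpolant K \<phi> z = K f"
    using interpolant_eq_covariance[OF K] by (simp add: f_def)
  have "(norm (interpolant K \<phi> z))\<^sup>2 = blinfun_apply f (interpolant K \<phi> z)"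
    using norm_sq_covariance[OF K] by (simp add: Kf)
  also have "\<dots> = (\<Sum>n < ?N. (\<Sum>i < ?N. vec_index z i * ?I $$ (i, n)) * vec_index z n)"
    by (simp add: f_def blinfun.sum_left blinfun.scaleR_left meas)
  also have "\<dots> = (\<Sum>i < ?N. vec_index z i * (\<Sum>n < ?N. ?I $$ (i, n) * vec_index z n))"
    unfolding sum_distrib_left sum_distrib_right by (subst sum.swap) (simp add: mult.assoc)
  also have "\<dots> = quad_form ?I z"
    using I z by (simp add: quad_form_def scalar_prod_def atLeast0LessThan)
  finally show ?thesis .
qed

text \<open>Pythagoras: the error \<open>v\<close> of interpolation is annihilated by every measurement, hence by the
  functional \<open>f\<close> with \<open>K f\<close> equal to the interpolant. Both mixed terms in the expansion of the squared
  norm equal \<open>f v\<close>.\<close>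

lemma norm_interpolant_pythagoras:
  assumes K: "covariance_operator K" and inv: "invertible_mat (gram_mat K \<phi>)"
  defines "w \<equiv> \<lambda>u. interpolant K \<phi> (pairing_vec \<phi> u)"
  shows "(norm u)\<^sup>2 = (norm (w u))\<^sup>2 + (norm (u - w u))\<^sup>2"
proof -
  obtain c where c: "w u = K (\<Sum>n < length \<phi>. c n *\<^sub>R \<phi> ! n)"
    using interpolant_eq_covariance[OF K] by (simp add: w_def)
  define f where "f = (\<Sum>n < length \<phi>. c n *\<^sub>R \<phi> ! n)"
  obtain g where g: "u - w u = K g"
    using K by (metis covariance_operator_def bij_pointE)
  have "blinfun_apply (\<phi> ! n) (w u) = blinfun_apply (\<phi> ! n) u" if "n < length \<phi>" for n
    using arg_cong[OF pairing_vec_interpolant[OF K inv pairing_vec_carrier[of \<phi> u]],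
        of "\<lambda>v. vec_index v n"] that
    by (simp add: pairing_vec_def w_def)
  then have fg: "blinfun_apply f (K g) = 0"
    unfolding g[symmetric]
    by (simp add: f_def blinfun.sum_left blinfun.scaleR_left blinfun.diff_right)
  then have gf: "blinfun_apply g (K f) = 0"
    using K by (simp add: covariance_operator_def)
  have u: "u = K (f + g)"
    using K c g by (simp add: covariance_operator_def linear_add f_def[symmetric])
      (metis add.commute diff_add_cancel)
  have "(norm u)\<^sup>2 = blinfun_apply (f + g) (K f + K g)"
    using norm_sq_covariance[OF K, of "f + g"] K
    by (simp add: u covariance_operator_def linear_add)
  also have "\<dots> = (norm (K f))\<^sup>2 + (norm (K g))\<^sup>2"
    by (simp add: norm_sq_covariance[OF K] blinfun.add_left blinfun.add_right fg gf)
  finally show ?thesis using c g by (simp add: f_def)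
qed

lemma norm_interpolant_pairing_vec_le:
  assumes "covariance_operator K" and "invertible_mat (gram_mat K \<phi>)"
  shows "(norm (interpolant K \<phi> (pairing_vec \<phi> u)))\<^sup>2 \<le> (norm u)\<^sup>2"
  using norm_interpolant_pythagoras[OF assms, of u] by simp

lemma interpolant_eq_if_norm_eq:
  assumes "covariance_operator K" and "invertible_mat (gram_mat K \<phi>)"
    and "(norm (interpolant K \<phi> (pairing_vec \<phi> u)))\<^sup>2 = (norm u)\<^sup>2"
  shows "interpolant K \<phi> (pairing_vec \<phi> u) = u"
  using norm_interpolant_pythagoras[OF assms(1,2), of u] assms(3) by simp

section \<open>Equivalence of the two minimization problems\<close>

text \<open>What makes the reduction work is that \<open>u\<close> and \<open>m\<close> enter the constraint \<open>c\<close> and the penalty \<open>h\<close>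
  through their measurements alone; \<open>c\<close> and \<open>h\<close> are otherwise arbitrary. Interpolation keeps both
  and can only decrease the norms.\<close>

lemma is_arg_min_representer:
  fixes h :: "real Matrix.vec \<Rightarrow> real Matrix.vec \<Rightarrow> real \<Rightarrow> real"
  assumes KU: "covariance_operator KU" "invertible_mat (gram_mat KU \<phi>)"
    and KV: "covariance_operator KV" "invertible_mat (gram_mat KV \<psi>)"
  shows
    "is_arg_min
       (\<lambda>(u, m, H). (norm u)\<^sup>2 + (norm m)\<^sup>2 + h (pairing_vec \<phi> u) (pairing_vec \<psi> m) H)
       (\<lambda>(u, m, H). c (pairing_vec \<phi> u) (pairing_vec \<psi> m) H)
       (u\<^sub>0, m\<^sub>0, H\<^sub>0)
     \<longleftrightarrow>
     (\<exists>z \<rho> \<mu>.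
        is_arg_min
          (\<lambda>(z, \<rho>, \<mu>). quad_form (inverse_mat (gram_mat KU \<phi>)) z
             + quad_form (inverse_mat (gram_mat KV \<psi>)) \<rho> + h z \<rho> \<mu>)
          (\<lambda>(z, \<rho>, \<mu>). z \<in> carrier_vec (length \<phi>) \<and> \<rho> \<in> carrier_vec (length \<psi>) \<and> c z \<rho> \<mu>)
          (z, \<rho>, \<mu>) \<and>
        u\<^sub>0 = interpolant KU \<phi> z \<and> m\<^sub>0 = interpolant KV \<psi> \<rho> \<and> H\<^sub>0 = \<mu>)"
    (is "is_arg_min ?F ?C ?a \<longleftrightarrow> (\<exists>z \<rho> \<mu>. is_arg_min ?F' ?C' (z, \<rho>, \<mu>) \<and> _ z \<rho> \<mu>)")
proof -
  define p :: "_ \<times> _ \<times> real \<Rightarrow> _"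
    where "p = (\<lambda>(u, m, H). (pairing_vec \<phi> u, pairing_vec \<psi> m, H))"
  define r :: "_ \<times> _ \<times> real \<Rightarrow> _"
    where "r = (\<lambda>(z, \<rho>, \<mu>). (interpolant KU \<phi> z, interpolant KV \<psi> \<rho>, \<mu>))"
  note simps = p_def r_def pairing_vec_carrier
    pairing_vec_interpolant[OF KU] pairing_vec_interpolant[OF KV]
  have "is_arg_min ?F ?C ?a \<longleftrightarrow> (\<exists>b. is_arg_min ?F' ?C' b \<and> ?a = r b)"
  proof (rule is_arg_min_retract[where p = p])
    fix a assume "?C a"
    obtain u m H where a: "a = (u, m, H)" by (cases a)
    let ?u = "interpolant KU \<phi> (pairing_vec \<phi> u)" and ?m = "interpolant KV \<psi> (pairing_vec \<psi> m)"
    have le: "(norm ?u)\<^sup>2 \<le> (norm u)\<^sup>2" "(norm ?m)\<^sup>2 \<le> (norm m)\<^sup>2"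
      by (rule norm_interpolant_pairing_vec_le[OF KU] norm_interpolant_pairing_vec_le[OF KV])+
    have rp: "?F (r (p a)) = (norm ?u)\<^sup>2 + (norm ?m)\<^sup>2 + h (pairing_vec \<phi> u) (pairing_vec \<psi> m) H"
      and F: "?F a = (norm u)\<^sup>2 + (norm m)\<^sup>2 + h (pairing_vec \<phi> u) (pairing_vec \<psi> m) H"
      by (simp_all add: a simps)
    show "?F (r (p a)) \<le> ?F a"
      unfolding rp F using le by linarith
    assume "?F (r (p a)) = ?F a"
    \<comment> \<open>Neither squared norm can grow, so equality of the sums forces equality of both.\<close>
    then have "(norm ?u)\<^sup>2 = (norm u)\<^sup>2" and "(norm ?m)\<^sup>2 = (norm m)\<^sup>2"
      unfolding rp F using le by linarith+
    then have "?u = u" and "?m = m"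
      by (simp_all add: interpolant_eq_if_norm_eq[OF KU] interpolant_eq_if_norm_eq[OF KV]
          del: power2_eq_iff_nonneg)
    then show "r (p a) = a"
      by (simp add: a p_def r_def)
  qed (auto simp: simps norm_interpolant[OF KU] norm_interpolant[OF KV])
  then show ?thesis by (simp add: r_def)
qed

lemma length_measurements:
  "b \<le> n \<Longrightarrow> length (measurements M\<Omega> M b n x L) = num_labels M\<Omega> M b n"
  by (simp add: measurements_def length_labels)

theorem theorem3p3:
  fixes \<Omega> :: "'a::euclidean_space set"
    and KU :: "('u::banach \<Rightarrow>\<^sub>L real) \<Rightarrow> 'u" and KV :: "('v::banach \<Rightarrow>\<^sub>L real) \<Rightarrow> 'v"
    and evU :: "'u \<Rightarrow> 'a \<Rightarrow> real" and evV :: "'v \<Rightarrow> 'a \<Rightarrow> real"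
    and \<P> :: "('a \<Rightarrow> real) \<Rightarrow> ('a \<Rightarrow> real) \<Rightarrow> real \<Rightarrow> 'a \<Rightarrow> 'p::euclidean_space"
    and \<B> :: "('a \<Rightarrow> real) \<Rightarrow> ('a \<Rightarrow> real) \<Rightarrow> 'a \<Rightarrow> 'b::euclidean_space"
    and k l Qb Q Db D M\<Omega> M NU NV :: nat
    and L :: "nat \<Rightarrow> 'u \<Rightarrow> 'a \<Rightarrow> real" and J :: "nat \<Rightarrow> 'v \<Rightarrow> 'a \<Rightarrow> real"
    and P :: "(nat \<Rightarrow> real) \<Rightarrow> (nat \<Rightarrow> real) \<Rightarrow> real \<Rightarrow> 'p"
    and B :: "(nat \<Rightarrow> real) \<Rightarrow> (nat \<Rightarrow> real) \<Rightarrow> 'b"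
    and x :: "nat \<Rightarrow> 'a" and \<beta> :: real
    and \<phi> :: "('u \<Rightarrow>\<^sub>L real) list" and \<psi> :: "('v \<Rightarrow>\<^sub>L real) list"
    and posU posV :: "nat \<Rightarrow> nat"
    and G :: "real Matrix.vec \<Rightarrow> real Matrix.vec \<Rightarrow> real \<Rightarrow> nat \<Rightarrow> 'p \<times> 'b"
    and \<Theta> \<Psi> :: "real Matrix.mat"
    and chi :: "nat \<Rightarrow> 'u" and eta :: "nat \<Rightarrow> 'v"
    and u\<^sub>0 :: 'u and m\<^sub>0 :: 'v and H\<^sub>0 :: real
  assumes "covariance_operator KU" and "covariance_operator KV"
    and "realizes_functions_on (closure \<Omega>) evU" and "realizes_functions_on (closure \<Omega>) evV"
    and "differential_operator \<Omega> k \<P>" and "boundary_operator \<Omega> k l \<B>"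
    and "mfg_uniquely_solvable \<Omega> k l \<P> \<B>"
    and "structural_assumption \<Omega> evU evV \<P> \<B> Qb Q L Db D J P B"
    and "\<beta> > 0"
    and "1 \<le> M\<Omega>" and "M\<Omega> \<le> M"
    and "\<And>i. 1 \<le> i \<Longrightarrow> i \<le> M\<Omega> \<Longrightarrow> x i \<in> interior \<Omega>"
    and "\<And>i. M\<Omega> + 1 \<le> i \<Longrightarrow> i \<le> M \<Longrightarrow> x i \<in> frontier \<Omega>"
    and "NU = num_labels M\<Omega> M Qb Q" and "\<phi> = measurements M\<Omega> M Qb Q x L"
    and "NV = num_labels M\<Omega> M Db D" and "\<psi> = measurements M\<Omega> M Db D x J"
    and "\<And>i. 1 \<le> i \<Longrightarrow> i \<le> M\<Omega> \<Longrightarrow>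
           posU i < NU \<and> (\<forall>u. blinfun_apply (\<phi> ! posU i) u = evU u (x i))"
    and "\<And>i. 1 \<le> i \<Longrightarrow> i \<le> M\<Omega> \<Longrightarrow>
           posV i < NV \<and> (\<forall>m. blinfun_apply (\<psi> ! posV i) m = evV m (x i))"
    and "G = constraint_map M\<Omega> M Qb Q Db D P B"
    and "\<Theta> = gram_mat KU \<phi>" and "invertible_mat \<Theta>"
    and "\<Psi> = gram_mat KV \<psi>" and "invertible_mat \<Psi>"
    and "chi = representer KU \<phi>" and "eta = representer KV \<psi>"
  shows
    "is_arg_min
       (\<lambda>(u, m, H). (norm u)\<^sup>2 + (norm m)\<^sup>2 + \<bar>H\<bar>\<^sup>2
          + \<beta> * \<bar>1 / real M\<Omega> * (\<Sum>i = 1..M\<Omega>. evU u (x i))\<bar>\<^sup>2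
          + \<beta> * \<bar>1 / real M\<Omega> * (\<Sum>i = 1..M\<Omega>. evV m (x i)) - 1\<bar>\<^sup>2)
       (\<lambda>(u, m, H). G (pairing_vec \<phi> u) (pairing_vec \<psi> m) H = (\<lambda>i. 0))
       (u\<^sub>0, m\<^sub>0, H\<^sub>0)
     \<longleftrightarrow>
     (\<exists>z\<^sub>0 \<rho>\<^sub>0 \<mu>\<^sub>0.
        is_arg_min
          (\<lambda>(z, \<rho>, \<mu>). quad_form (inverse_mat \<Theta>) z + quad_form (inverse_mat \<Psi>) \<rho> + \<bar>\<mu>\<bar>\<^sup>2
             + \<beta> * \<bar>1 / real M\<Omega> * (\<Sum>i = 1..M\<Omega>. vec_index z (posU i))\<bar>\<^sup>2
             + \<beta> * \<bar>1 / real M\<Omega> * (\<Sum>i = 1..M\<Omega>. vec_index \<rho> (posV i)) - 1\<bar>\<^sup>2)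
          (\<lambda>(z, \<rho>, \<mu>). z \<in> carrier_vec NU \<and> \<rho> \<in> carrier_vec NV \<and> G z \<rho> \<mu> = (\<lambda>i. 0))
          (z\<^sub>0, \<rho>\<^sub>0, \<mu>\<^sub>0) \<and>
        u\<^sub>0 = (\<Sum>i < NU. vec_index z\<^sub>0 i *\<^sub>R chi i) \<and>
        m\<^sub>0 = (\<Sum>i < NV. vec_index \<rho>\<^sub>0 i *\<^sub>R eta i) \<and>
        H\<^sub>0 = \<mu>\<^sub>0)"
proof -
  have N: "length \<phi> = NU" "length \<psi> = NV"
    using assms by (simp_all add: structural_assumption_def length_measurements)
  have U: "evU u (x i) = vec_index (pairing_vec \<phi> u) (posU i)" if "i \<in> {1..M\<Omega>}" for u i
    using assms(18)[of i] that N by (simp add: pairing_vec_def)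
  have V: "evV m (x i) = vec_index (pairing_vec \<psi> m) (posV i)" if "i \<in> {1..M\<Omega>}" for m i
    using assms(19)[of i] that N by (simp add: pairing_vec_def)
  have sums:
    "(\<Sum>i = 1..M\<Omega>. evU u (x i)) = (\<Sum>i = 1..M\<Omega>. vec_index (pairing_vec \<phi> u) (posU i))"
    "(\<Sum>i = 1..M\<Omega>. evV m (x i)) = (\<Sum>i = 1..M\<Omega>. vec_index (pairing_vec \<psi> m) (posV i))" for u m
    by (intro sum.cong refl U V; assumption)+
  define h where "h = (\<lambda>z \<rho> \<mu>. \<bar>\<mu>\<bar>\<^sup>2
     + \<beta> * \<bar>1 / real M\<Omega> * (\<Sum>i = 1..M\<Omega>. vec_index z (posU i))\<bar>\<^sup>2
     + \<beta> * \<bar>1 / real M\<Omega> * (\<Sum>i = 1..M\<Omega>. vec_index \<rho> (posV i)) - 1\<bar>\<^sup>2)"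
  have chi: "(\<Sum>i < NU. vec_index z i *\<^sub>R chi i) = interpolant KU \<phi> z" for z
    using assms(25) by (simp add: interpolant_def N)
  have eta: "(\<Sum>i < NV. vec_index \<rho> i *\<^sub>R eta i) = interpolant KV \<psi> \<rho>" for \<rho>
    using assms(26) by (simp add: interpolant_def N)
  have inv: "invertible_mat (gram_mat KU \<phi>)" "invertible_mat (gram_mat KV \<psi>)"
    using assms(21-24) by simp_all
  from is_arg_min_representer[OF assms(1) inv(1) assms(2) inv(2),
      of h "\<lambda>z \<rho> \<mu>. G z \<rho> \<mu> = (\<lambda>i. 0)" u\<^sub>0 m\<^sub>0 H\<^sub>0]
  show ?thesis
    unfolding sums chi eta assms(21) assms(23) N h_def add.assoc .
qed

end
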